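(* Let $\lambda \in P^+$, let $X \subseteq \mathcal{B}(\lambda)$ be an extremal subset, and let $\{z_1,\ldots,z_k\}$ be its set of lowest weight elements. Then $X = \mathcal{E}(\{z_1,\ldots,z_k\})$.
   Context: Let $G$ be a connected, simply connected, complex semisimple Lie group (arbitrary finite type) with Lie algebra $\mathfrak{g}$, Dynkin index set $I$, weight lattice $P$, simple roots $\alpha_i$, simple coroots $\alpha_i^\vee$ ($i\in I$), and dominant weights $P^+ = \{\lambda \in P : \langle \lambda, \alpha_i^\vee\rangle \ge 0 \text{ for all } i \in I\}$. $\mathcal{B}(\lambda)$ denotes the highest weight crystal of the simple module $V(\lambda)$, i.e. the crystal of the crystal basis of the irreducible $U_q(\mathfrak{g})$-module of highest weight $\lambda$: a finite set with weight map $\mathrm{wt}:\mathcal{B}(\lambda)\to P$ and raising and lowering operators $e_i, f_i : \mathcal{B}(\lambda) \to \mathcal{B}(\lambda) \sqcup \{0\}$ ($i \in I$) such that $f_i(x)=y$ iff $e_i(y)=x$, in which case $\mathrm{wt}(y)=\mathrm{wt}(x)-\alpha_i$; $\varphi_i(x)=\max\{k: f_i^k(x)\neq 0\}$, $\varepsilon_i(x)=\max\{k: e_i^k(x)\ne 0\}$, $\varphi_i(x)=\langle \mathrm{wt}(x),\alpha_i^\vee\rangle+\varepsilon_i(x)$. It has a highest weight element $b_\lambda$ with $\mathrm{wt}(b_\lambda)=\lambda$ and $e_i(b_\lambda)=0$ for all $i$. An $i$-string is an equivalence class of the relation on $\mathcal{B}(\lambda)$ given by $x \sim_i y$ iff $x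 = e_i^k(y)$ or $y = e_i^k(x)$ for some $k \ge 0$; each $i$-string $S$ contains a unique element $u_S$ with $e_i(u_S)=0$, its highest weight element. A subset $X \subseteq \mathcal{B}(\lambda)$ is extremal if for every $i \in I$ and every $i$-string $S$ in $\mathcal{B}(\lambda)$, $S \cap X \in \{\emptyset, \{u_S\}, S\}$. Given an extremal subset $X$, an element $x \in X$ is a lowest weight element of $X$ if for each $i \in I$, either $f_i(x)=0$ or $f_i(x) \notin X$. For $X \subseteq \mathcal{B}(\lambda)$, $\mathcal{E}(X) = \{ e_{i_k}^{d_k}\cdots e_{i_1}^{d_1}(x) : x \in X,\ i_j \in I,\ d_j \ge 0\} \setminus \{0\}$ (over all finite sequences of indices and exponents). *)

theory Defs
  imports
    Complex_Main
    "HOL-Computational_Algebra.Polynomial"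
    "HOL-Computational_Algebra.Fraction_Field"
begin

section \<open>Cartan data of finite type and weights\<close>

text \<open>
  The connected, simply connected complex semisimple group enters through its Cartan matrix
  \<open>a\<^sub>i\<^sub>j = \<langle>\<alpha>\<^sub>j, \<alpha>\<^sub>i\<^sup>\<or>\<rangle>\<close> together with positive integers \<open>d\<^sub>i\<close> such that
  \<open>d\<^sub>i a\<^sub>i\<^sub>j = (\<alpha>\<^sub>i, \<alpha>\<^sub>j)\<close> for a Weyl group invariant inner product. Any such symmetrizer is allowed;
  the usual normalization takes the \<open>d\<^sub>i\<close> coprime.
\<close>

record 'i cartan_datum =
  cartan :: "'i \<Rightarrow> 'i \<Rightarrow> int"
  symmetrizer :: "'i \<Rightarrow> nat"

definition finite_type :: "'i::finite cartan_datum \<Rightarrow> bool" where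
  "finite_type D \<longleftrightarrow>
     (\<forall>i. cartan D i i = 2) \<and>
     (\<forall>i j. i \<noteq> j \<longrightarrow> cartan D i j \<le> 0) \<and>
     (\<forall>i j. cartan D i j = 0 \<longleftrightarrow> cartan D j i = 0) \<and>
     (\<forall>i. symmetrizer D i > 0) \<and>
     (\<forall>i j. int (symmetrizer D i) * cartan D i j = int (symmetrizer D j) * cartan D j i) \<and>
     (\<forall>x :: 'i \<Rightarrow> real. x \<noteq> (\<lambda>_. 0) \<longrightarrow>
        (\<Sum>i\<in>UNIV. \<Sum>j\<in>UNIV. real (symmetrizer D i) * of_int (cartan D i j) * x i * x j) > 0)"

text \<open>
  As the group is simply connected, \<open>P\<close> is free on the fundamental weights, and a weight \<open>\<mu>\<close> is
  encoded by its coordinates \<open>\<mu> i = \<langle>\<mu>, \<alpha>\<^sub>i\<^sup>\<or>\<rangle>\<close>.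
\<close>

type_synonym 'i weight = "'i \<Rightarrow> int"

definition dominant :: "'i weight \<Rightarrow> bool" where
  "dominant \<mu> \<longleftrightarrow> (\<forall>i. \<mu> i \<ge> 0)"


section \<open>Modules over the quantized enveloping algebra\<close>

type_synonym qfield = "rat poly fract"

definition qvar :: qfield where
  "qvar = Fract [:0, 1:] 1"

definition qconst :: "rat \<Rightarrow> qfield" where
  "qconst c = Fract [:c:] 1"

text \<open>The local ring of rational functions in \<open>q\<close> that are regular at \<open>q = 0\<close>.\<close>

definition regular_at_0 :: "qfield set" where
  "regular_at_0 = {Fract a b | a b. poly b 0 \<noteq> 0}"

definition q_i :: "'i cartan_datum \<Rightarrow> 'i \<Rightarrow> qfield" where
  "q_i D i = qvar ^ symmetrizer D i"

definition qint :: "'i cartan_datum \<Rightarrow> 'i \<Rightarrow> nat \<Rightarrow> qfield" where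
  "qint D i n =
     (q_i D i powi int n - q_i D i powi (- int n)) / (q_i D i - inverse (q_i D i))"

definition qfact :: "'i cartan_datum \<Rightarrow> 'i \<Rightarrow> nat \<Rightarrow> qfield" where
  "qfact D i n = (\<Prod>m=1..n. qint D i m)"

text \<open>
  A module is given by the action of the Drinfeld--Jimbo generators
  \<open>E\<^sub>i\<close>, \<open>F\<^sub>i\<close>, \<open>K\<^sub>i\<close> on the whole type \<open>'v\<close>; \<open>K\<^sub>i\<close> stands for \<open>q\<close> to the power \<open>d\<^sub>i \<alpha>\<^sub>i\<^sup>\<or>\<close>.
\<close>

record ('i, 'v) uq_rep =
  smult :: "qfield \<Rightarrow> 'v \<Rightarrow> 'v"
  opE :: "'i \<Rightarrow> 'v \<Rightarrow> 'v"
  opF :: "'i \<Rightarrow> 'v \<Rightarrow> 'v"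
  opK :: "'i \<Rightarrow> 'v \<Rightarrow> 'v"

definition div_power ::
  "'i cartan_datum \<Rightarrow> ('i, 'v) uq_rep \<Rightarrow> ('i \<Rightarrow> 'v \<Rightarrow> 'v) \<Rightarrow> 'i \<Rightarrow> nat \<Rightarrow> 'v \<Rightarrow> 'v" where
  "div_power D M X i n v = smult M (inverse (qfact D i n)) ((X i ^^ n) v)"

definition quantum_serre ::
  "'i cartan_datum \<Rightarrow> ('i, 'v::ab_group_add) uq_rep \<Rightarrow> ('i \<Rightarrow> 'v \<Rightarrow> 'v) \<Rightarrow> bool" where
  "quantum_serre D M X \<longleftrightarrow> (\<forall>i j v. i \<noteq> j \<longrightarrow>
     (let m = nat (1 - cartan D i j) in
       (\<Sum>k=0..m. smult M ((- 1) ^ k)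
          (div_power D M X i (m - k) (X j (div_power D M X i k v)))) = 0))"

definition uq_module :: "'i cartan_datum \<Rightarrow> ('i, 'v::ab_group_add) uq_rep \<Rightarrow> bool" where
  "uq_module D M \<longleftrightarrow>
     vector_space (smult M) \<and>
     (\<forall>i. Vector_Spaces.linear (smult M) (smult M) (opE M i)) \<and>
     (\<forall>i. Vector_Spaces.linear (smult M) (smult M) (opF M i)) \<and>
     (\<forall>i. Vector_Spaces.linear (smult M) (smult M) (opK M i)) \<and>
     (\<forall>i. bij (opK M i)) \<and>
     (\<forall>i j v. opK M i (opK M j v) = opK M j (opK M i v)) \<and>
     (\<forall>i j v. opK M i (opE M j v) = smult M (q_i D i powi cartan D i j) (opE M j (opK M i v))) \<and>
     (\<forall>i j v. opK M i (opF M j v) = smult M (q_i D i powi (- cartan D i j)) (opF M j (opK M i v))) \<and>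
     (\<forall>i j v. opE M i (opF M j v) - opF M j (opE M i v) =
        (if i = j then smult M (inverse (q_i D i - inverse (q_i D i))) (opK M i v - inv (opK M i) v)
         else 0)) \<and>
     quantum_serre D M (opE M) \<and>
     quantum_serre D M (opF M)"

definition weight_space ::
  "'i cartan_datum \<Rightarrow> ('i, 'v) uq_rep \<Rightarrow> 'i weight \<Rightarrow> 'v set" where
  "weight_space D M \<mu> = {v. \<forall>i. opK M i v = smult M (q_i D i powi \<mu> i) v}"

definition uq_submodule :: "('i, 'v::ab_group_add) uq_rep \<Rightarrow> 'v set \<Rightarrow> bool" where
  "uq_submodule M W \<longleftrightarrow>
     module.subspace (smult M) W \<and>
     (\<forall>i. \<forall>v\<in>W. opE M i v \<in> W \<and> opF M i v \<in> W \<and> opK M i v \<in> W \<and> inv (opK M i) v \<in> W)"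

definition irreducible_module :: "('i, 'v::ab_group_add) uq_rep \<Rightarrow> bool" where
  "irreducible_module M \<longleftrightarrow>
     (UNIV :: 'v set) \<noteq> {0} \<and> (\<forall>W. uq_submodule M W \<longrightarrow> W = {0} \<or> W = UNIV)"

definition highest_weight_vector ::
  "'i cartan_datum \<Rightarrow> ('i, 'v::ab_group_add) uq_rep \<Rightarrow> 'i weight \<Rightarrow> 'v \<Rightarrow> bool" where
  "highest_weight_vector D M \<mu> v \<longleftrightarrow>
     v \<noteq> 0 \<and> v \<in> weight_space D M \<mu> \<and> (\<forall>i. opE M i v = 0)"

text \<open>\<open>M\<close> is a realization of the simple module \<open>V(\<mu>)\<close>.\<close>

definition simple_highest_weight_module ::
  "'i cartan_datum \<Rightarrow> ('i, 'v::ab_group_add) uq_rep \<Rightarrow> 'i weight \<Rightarrow> bool" where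
  "simple_highest_weight_module D M \<mu> \<longleftrightarrow>
     uq_module D M \<and>
     (\<exists>S. finite S \<and> module.span (smult M) S = UNIV) \<and>
     irreducible_module M \<and>
     (\<exists>v. highest_weight_vector D M \<mu> v)"


section \<open>Kashiwara operators and crystal bases\<close>

text \<open>
  In a finite-dimensional module with a weight decomposition, every vector is in exactly one way a
  sum of vectors \<open>F\<^sub>i\<^sup>(\<^sup>n\<^sup>) u\<close> with \<open>u \<in> ker E\<^sub>i\<close> of weight \<open>\<mu>\<close> and \<open>0 \<le> n \<le> \<langle>\<mu>, \<alpha>\<^sub>i\<^sup>\<or>\<rangle>\<close>. The Kashiwara
  operators shift the exponent \<open>n\<close> of the divided power. They are given the value \<open>0\<close> on vectors
  without a unique decomposition (there are none in the modules of interest).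
\<close>

definition string_decomposition ::
  "'i cartan_datum \<Rightarrow> ('i, 'v::ab_group_add) uq_rep \<Rightarrow> 'i \<Rightarrow> 'v \<Rightarrow> ('i weight \<times> nat \<Rightarrow> 'v) \<Rightarrow> bool"
  where
  "string_decomposition D M i v u \<longleftrightarrow>
     finite {p. u p \<noteq> 0} \<and>
     (\<forall>\<mu> n. u (\<mu>, n) \<in> weight_space D M \<mu> \<and> opE M i (u (\<mu>, n)) = 0) \<and>
     (\<forall>\<mu> n. u (\<mu>, n) \<noteq> 0 \<longrightarrow> int n \<le> \<mu> i) \<and>
     v = (\<Sum>p | u p \<noteq> 0. div_power D M (opF M) i (snd p) (u p))"

definition kashiwara_f ::
  "'i cartan_datum \<Rightarrow> ('i, 'v::ab_group_add) uq_rep \<Rightarrow> 'i \<Rightarrow> 'v \<Rightarrow> 'v" where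
  "kashiwara_f D M i v =
     (if \<exists>!u. string_decomposition D M i v u
      then let u = (THE u. string_decomposition D M i v u)
           in \<Sum>p | u p \<noteq> 0. div_power D M (opF M) i (snd p + 1) (u p)
      else 0)"

definition kashiwara_e ::
  "'i cartan_datum \<Rightarrow> ('i, 'v::ab_group_add) uq_rep \<Rightarrow> 'i \<Rightarrow> 'v \<Rightarrow> 'v" where
  "kashiwara_e D M i v =
     (if \<exists>!u. string_decomposition D M i v u
      then let u = (THE u. string_decomposition D M i v u)
           in \<Sum>p | u p \<noteq> 0 \<and> snd p \<noteq> 0. div_power D M (opF M) i (snd p - 1) (u p)
      else 0)"

text \<open>
  A lattice \<open>L\<close> is a free submodule over the local ring whose extension of scalars to the field of
  rational functions is the whole module; equivalently, it is spanned over the local ring by a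
  vector space basis. It has to be the direct sum of its weight parts.
\<close>

definition crystal_lattice ::
  "'i cartan_datum \<Rightarrow> ('i, 'v::ab_group_add) uq_rep \<Rightarrow> 'v set \<Rightarrow> bool" where
  "crystal_lattice D M L \<longleftrightarrow>
     (\<exists>S. finite S \<and> module.independent (smult M) S \<and> module.span (smult M) S = UNIV \<and>
        L = {\<Sum>s\<in>S. smult M (a s) s | a. \<forall>s\<in>S. a s \<in> regular_at_0}) \<and>
     (\<forall>v\<in>L. \<exists>!g :: 'i weight \<Rightarrow> 'v.
        finite {\<mu>. g \<mu> \<noteq> 0} \<and> (\<forall>\<mu>. g \<mu> \<in> L \<inter> weight_space D M \<mu>) \<and>
        v = (\<Sum>\<mu> | g \<mu> \<noteq> 0. g \<mu>)) \<and>
     (\<forall>i. \<forall>v\<in>L. kashiwara_e D M i v \<in> L \<and> kashiwara_f D M i v \<in> L)"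

text \<open>The class of \<open>v\<close> in \<open>L / q L\<close>; the zero of the quotient is the class of \<open>0\<close>.\<close>

definition q_class :: "('i, 'v::ab_group_add) uq_rep \<Rightarrow> 'v set \<Rightarrow> 'v \<Rightarrow> 'v set" where
  "q_class M L v = {v + smult M qvar w | w. w \<in> L}"

definition induced_op ::
  "('i, 'v::ab_group_add) uq_rep \<Rightarrow> 'v set \<Rightarrow> ('v \<Rightarrow> 'v) \<Rightarrow> 'v set \<Rightarrow> 'v set" where
  "induced_op M L T b = (\<Union>v\<in>b. q_class M L (T v))"

text \<open>
  \<open>B\<close> is a basis of the rational vector space \<open>L / q L\<close>. A linear combination of classes is computed
  on representatives, the choice of which does not matter.
\<close>

definition basis_mod_q :: "('i, 'v::ab_group_add) uq_rep \<Rightarrow> 'v set \<Rightarrow> 'v set set \<Rightarrow> bool" where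
  "basis_mod_q M L B \<longleftrightarrow>
     B \<subseteq> q_class M L ` L \<and>
     (\<forall>v\<in>L. \<exists>!c :: 'v set \<Rightarrow> rat.
        finite {b. c b \<noteq> 0} \<and> {b. c b \<noteq> 0} \<subseteq> B \<and>
        q_class M L v =
          q_class M L (\<Sum>b | c b \<noteq> 0. smult M (qconst (c b)) (SOME w. w \<in> b)))"

definition crystal_basis ::
  "'i cartan_datum \<Rightarrow> ('i, 'v::ab_group_add) uq_rep \<Rightarrow> 'v set \<Rightarrow> 'v set set \<Rightarrow> bool" where
  "crystal_basis D M L B \<longleftrightarrow>
     crystal_lattice D M L \<and>
     basis_mod_q M L B \<and>
     (\<forall>b\<in>B. \<exists>!\<mu>. b \<in> q_class M L ` (L \<inter> weight_space D M \<mu>)) \<and>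
     (\<forall>i. \<forall>b\<in>B. induced_op M L (kashiwara_e D M i) b \<in> insert (q_class M L 0) B \<and>
                 induced_op M L (kashiwara_f D M i) b \<in> insert (q_class M L 0) B) \<and>
     (\<forall>i. \<forall>b\<in>B. \<forall>b'\<in>B. induced_op M L (kashiwara_f D M i) b = b' \<longleftrightarrow>
                        induced_op M L (kashiwara_e D M i) b' = b)"


section \<open>Crystals and extremal subsets\<close>

text \<open>The value \<open>None\<close> of the operators plays the role of the extra element \<open>0\<close>.\<close>

record ('i, 'b) crystal =
  elems :: "'b set"
  raise :: "'i \<Rightarrow> 'b \<Rightarrow> 'b option"
  lower :: "'i \<Rightarrow> 'b \<Rightarrow> 'b option"

definition crystal_of_basis ::
  "'i cartan_datum \<Rightarrow> ('i, 'v::ab_group_add) uq_rep \<Rightarrow> 'v set \<Rightarrow> 'v set set \<Rightarrow> ('i, 'v set) crystal"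
  where
  "crystal_of_basis D M L B =
     \<lparr> elems = B,
       raise = (\<lambda>i b. let b' = induced_op M L (kashiwara_e D M i) b
                      in if b' = q_class M L 0 then None else Some b'),
       lower = (\<lambda>i b. let b' = induced_op M L (kashiwara_f D M i) b
                      in if b' = q_class M L 0 then None else Some b') \<rparr>"

text \<open>The crystal \<open>C\<close> is the highest weight crystal \<open>\<B>(\<mu>)\<close>, for some realization on \<open>'v\<close>.\<close>

definition highest_weight_crystal ::
  "'i cartan_datum \<Rightarrow> ('i, 'v::ab_group_add) uq_rep \<Rightarrow> 'i weight \<Rightarrow> ('i, 'v set) crystal \<Rightarrow> bool" where
  "highest_weight_crystal D M \<mu> C \<longleftrightarrow>
     simple_highest_weight_module D M \<mu> \<and>
     (\<exists>L B. crystal_basis D M L B \<and> C = crystal_of_basis D M L B)"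

definition raise_pow :: "('i, 'b) crystal \<Rightarrow> 'i \<Rightarrow> nat \<Rightarrow> 'b \<Rightarrow> 'b option" where
  "raise_pow C i k x = ((\<lambda>y. Option.bind y (raise C i)) ^^ k) (Some x)"

definition string_rel :: "('i, 'b) crystal \<Rightarrow> 'i \<Rightarrow> ('b \<times> 'b) set" where
  "string_rel C i = {(x, y). x \<in> elems C \<and> y \<in> elems C \<and>
     (\<exists>k. Some x = raise_pow C i k y \<or> Some y = raise_pow C i k x)}"

definition strings :: "('i, 'b) crystal \<Rightarrow> 'i \<Rightarrow> 'b set set" where
  "strings C i = elems C // string_rel C i"

definition string_top :: "('i, 'b) crystal \<Rightarrow> 'i \<Rightarrow> 'b set \<Rightarrow> 'b" where
  "string_top C i S = (THE u. u \<in> S \<and> raise C i u = None)"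

definition extremal :: "('i, 'b) crystal \<Rightarrow> 'b set \<Rightarrow> bool" where
  "extremal C X \<longleftrightarrow>
     X \<subseteq> elems C \<and>
     (\<forall>i. \<forall>S\<in>strings C i. S \<inter> X \<in> {{}, {string_top C i S}, S})"

definition lowest_weight_elements :: "('i, 'b) crystal \<Rightarrow> 'b set \<Rightarrow> 'b set" where
  "lowest_weight_elements C X =
     {x \<in> X. \<forall>i. lower C i x = None \<or> (\<exists>y. lower C i x = Some y \<and> y \<notin> X)}"

text \<open>The list is read from left to right: its first entry is applied first.\<close>

definition raise_seq :: "('i, 'b) crystal \<Rightarrow> ('i \<times> nat) list \<Rightarrow> 'b \<Rightarrow> 'b option" where
  "raise_seq C ps x = fold (\<lambda>(i, d) y. Option.bind y (raise_pow C i d)) ps (Some x)"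

definition raising_closure :: "('i, 'b) crystal \<Rightarrow> 'b set \<Rightarrow> 'b set" where
  "raising_closure C X = {y. \<exists>x\<in>X. \<exists>ps. raise_seq C ps x = Some y}"

end

theory Submission
  imports Defs
begin

text \<open>
  Both inclusions are short once the operators on the crystal are known not to run forever. From
  any \<open>x \<in> X\<close>, keep applying lowering operators as long as the result stays in \<open>X\<close>. The process
  stops, by definition at a lowest weight element of \<open>X\<close>, and undoing the steps with raising
  operators leads back to \<open>x\<close>. Conversely, an extremal set is stable under raising
  (\<open>extremal_raise_closed\<close>): if \<open>e\<^sub>i x \<noteq> 0\<close>, then \<open>x\<close> is not the top of its \<open>i\<close>-string, so \<open>X\<close> contains
  the whole string.

  The content lies in termination. In a crystal basis each element has a weight, and \<open>f\<^sub>i\<close> lowers it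
  by \<open>\<alpha>\<^sub>i\<close> (\<open>basis_wt_kashiwara_f\<close>). As the form given by the symmetrized Cartan matrix is positive
  definite, no nontrivial sum of simple roots is zero, so weights never recur along a sequence of
  lowering steps (\<open>acyclic_root_step\<close>). Only finitely many weights occur in a finite-dimensional
  module, because weight vectors of distinct weights are linearly independent (\<open>finite_weights\<close>).
  Hence lowering and raising are both well-founded.

  That the Kashiwara operator \<open>f\<^sub>i\<close> is homogeneous follows from the uniqueness of string
  decompositions: rescaling each summand by the eigenvalue of \<open>K\<^sub>j\<close> on it gives another decomposition
  of the same weight vector, so all summands have its weight (\<open>string_decomposition_support\<close>).
\<close>

section \<open>Well-founded crystals\<close>

locale wellfounded_crystal =
  fixes C :: "('i, 'b) crystal"
  assumes raise_closed: "x \<in> elems C \<Longrightarrow> raise C i x = Some y \<Longrightarrow> y \<in> elems C"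
    and lower_imp_raise: "x \<in> elems C \<Longrightarrow> lower C i x = Some y \<Longrightarrow> raise C i y = Some x"
    and wf_lower: "wf {(y, x). x \<in> elems C \<and> (\<exists>i. lower C i x = Some y)}"
    and wf_raise: "wf {(y, x). x \<in> elems C \<and> (\<exists>i. raise C i x = Some y)}"
begin

lemma raise_pow_0 [simp]: "raise_pow C i 0 x = Some x"
  by (simp add: raise_pow_def)

lemma raise_pow_Suc: "raise_pow C i (Suc k) x = Option.bind (raise_pow C i k x) (raise C i)"
  by (simp add: raise_pow_def)

lemma raise_pow_Suc_left:
  "raise_pow C i (Suc k) x = (case raise C i x of None \<Rightarrow> None | Some y \<Rightarrow> raise_pow C i k y)"
proof -
  have "((\<lambda>y. Option.bind y (raise C i)) ^^ k) None = None" by (induction k) auto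
  then show ?thesis
    by (simp add: raise_pow_def funpow_Suc_right del: funpow.simps split: option.split)
qed

lemma raise_pow_closed:
  assumes step: "\<And>x y. x \<in> A \<Longrightarrow> raise C i x = Some y \<Longrightarrow> y \<in> A"
    and "x \<in> A" "raise_pow C i k x = Some y"
  shows "y \<in> A"
  using assms(3)
proof (induction k arbitrary: y)
  case (Suc k)
  then obtain w where "raise_pow C i k x = Some w" "raise C i w = Some y"
    by (auto simp: raise_pow_Suc bind_eq_Some_conv)
  with Suc.IH step show ?case by blast
qed (use \<open>x \<in> A\<close> in simp)

lemma raise_seq_closed:
  assumes step: "\<And>i x y. x \<in> A \<Longrightarrow> raise C i x = Some y \<Longrightarrow> y \<in> A"
    and "x \<in> A" "raise_seq C ps x = Some y"
  shows "y \<in> A"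
  using assms(3)
proof (induction ps arbitrary: y rule: rev_induct)
  case (snoc p ps)
  obtain i d where p: "p = (i, d)" by force
  from snoc.prems obtain w where "raise_seq C ps x = Some w" "raise_pow C i d w = Some y"
    by (auto simp: raise_seq_def p bind_eq_Some_conv)
  with snoc.IH raise_pow_closed[of A i w d y] step show ?case by blast
qed (use \<open>x \<in> A\<close> in \<open>simp add: raise_seq_def\<close>)

lemma raise_pow_reaches_top:
  assumes "x \<in> elems C"
  shows "\<exists>k u. raise_pow C i k x = Some u \<and> raise C i u = None"
  using wf_raise assms
proof (induction x rule: wf_induct_rule)
  case (less x)
  show ?case
  proof (cases "raise C i x")
    case None
    then show ?thesis by (intro exI[of _ 0]) simp
  next
    case (Some y)
    with less raise_closed obtain k u where "raise_pow C i k y = Some u" "raise C i u = None"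
      by blast
    with Some show ?thesis by (intro exI[of _ "Suc k"]) (simp add: raise_pow_Suc_left)
  qed
qed

lemma raise_pow_top_unique:
  assumes "raise_pow C i k x = Some u" "raise C i u = None"
    and "raise_pow C i l x = Some w" "raise C i w = None"
  shows "u = w"
  using assms
proof (induction k arbitrary: l x)
  case 0
  then show ?case by (cases l) (auto simp: raise_pow_Suc_left)
next
  case (Suc k)
  then show ?case
    by (cases l) (auto simp: raise_pow_Suc_left split: option.splits)
qed

text \<open>
  Well-foundedness of raising is needed for the top to exist: the top is a definite description, about
  which nothing is known unless the string contains exactly one element killed by \<open>e\<^sub>i\<close>. Following \<open>e\<^sub>i\<close>
  upwards from \<open>x\<close> finds such an element, and there is no other: an element below \<open>x\<close> can be raised.
\<close>

lemma raise_string_top: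
  assumes x: "x \<in> elems C" and nt: "raise C i x \<noteq> None"
  defines "S \<equiv> string_rel C i `` {x}"
  shows "raise C i (string_top C i S) = None"
proof -
  obtain k u where u: "raise_pow C i k x = Some u" "raise C i u = None"
    using raise_pow_reaches_top[OF x] by blast
  have "u \<in> elems C"
    using raise_pow_closed[of "elems C", OF raise_closed x u(1)] .
  then have uS: "u \<in> S"
    using x u(1) unfolding S_def string_rel_def by (auto intro!: exI[of _ k])
  have uniq: "w = u" if w: "w \<in> S" "raise C i w = None" for w
  proof -
    from w(1) obtain l where l: "Some x = raise_pow C i l w \<or> Some w = raise_pow C i l x"
      unfolding S_def string_rel_def by auto
    have "\<not> Some x = raise_pow C i l w"
      using w(2) nt by (cases l) (auto simp: raise_pow_Suc_left)
    with l have "raise_pow C i l x = Some w" by simp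
    with raise_pow_top_unique u w(2) show ?thesis by blast
  qed
  have "string_top C i S \<in> S \<and> raise C i (string_top C i S) = None"
    unfolding string_top_def
  proof (rule theI)
    show "u \<in> S \<and> raise C i u = None" using uS u(2) by blast
  qed (use uniq in blast)
  then show ?thesis by simp
qed

text \<open>
  An element that can be raised is not the top of its string, so of the three permitted intersections
  of \<open>X\<close> with that string only the whole string remains.
\<close>

lemma extremal_raise_closed:
  assumes "extremal C X" "x \<in> X" "raise C i x = Some y"
  shows "y \<in> X"
proof -
  define S where "S = string_rel C i `` {x}"
  have x: "x \<in> elems C" using assms by (auto simp: extremal_def)
  then have xS: "x \<in> S"
    by (auto simp: S_def string_rel_def intro!: exI[of _ 0])
  have "raise_pow C i 1 x = Some y" using assms(3) by (simp add: raise_pow_Suc)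
  then have yS: "y \<in> S"
    using x raise_closed[OF x assms(3)]
    unfolding S_def string_rel_def by (auto intro!: exI[of _ 1])
  have "S \<in> strings C i"
    using x by (auto simp: strings_def S_def intro: quotientI)
  then have "S \<inter> X \<in> {{}, {string_top C i S}, S}"
    using assms(1) by (auto simp: extremal_def)
  moreover have "x \<noteq> string_top C i S"
    using raise_string_top[OF x, of i] assms(3) by (auto simp: S_def)
  ultimately show ?thesis using xS yS assms(2) by auto
qed

theorem extremal_eq_raising_closure:
  assumes "extremal C X"
  shows "X = raising_closure C (lowest_weight_elements C X)"
proof
  show "raising_closure C (lowest_weight_elements C X) \<subseteq> X"
    unfolding raising_closure_def lowest_weight_elements_def
    using raise_seq_closed[of X] extremal_raise_closed[OF assms] by blast
next
  have "x \<in> raising_closure C (lowest_weight_elements C X)" if "x \<in> X" for x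
    using wf_lower that
  proof (induction x rule: wf_induct_rule)
    case (less x)
    have x: "x \<in> elems C" using less.prems assms by (auto simp: extremal_def)
    show ?case
    proof (cases "x \<in> lowest_weight_elements C X")
      case True
      moreover have "raise_seq C [] x = Some x" by (simp add: raise_seq_def)
      ultimately show ?thesis unfolding raising_closure_def by blast
    next
      case False
      then obtain i y where y: "lower C i x = Some y" "y \<in> X"
        using less.prems by (auto simp: lowest_weight_elements_def)
      then obtain z ps where z: "z \<in> lowest_weight_elements C X" "raise_seq C ps z = Some y"
        using less.IH[of y] x by (auto simp: raising_closure_def)
      then have "raise_seq C (ps @ [(i, 1)]) z = Some x"
        using lower_imp_raise[OF x y(1)] by (simp add: raise_seq_def raise_pow_Suc)
      with z(1) show ?thesis unfolding raising_closure_def by blast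
    qed
  qed
  then show "X \<subseteq> raising_closure C (lowest_weight_elements C X)" by blast
qed

end


section \<open>Weights of a module over the quantized enveloping algebra\<close>

lemma qvar_power: "qvar ^ n = Fract (monom 1 n) 1"
  by (induction n) (simp_all add: qvar_def One_fract_def monom_Suc)

lemma qvar_nonzero [simp]: "qvar \<noteq> 0"
  by (simp add: qvar_def Zero_fract_def eq_fract)

lemma qvar_power_eq_1_iff: "qvar ^ n = 1 \<longleftrightarrow> n = 0"
  by (auto simp: qvar_power One_fract_def eq_fract monom_eq_1_iff)

text \<open>
  The variable \<open>q\<close> is not a root of unity. This is what makes a weight recoverable from the
  eigenvalues of the operators \<open>K\<^sub>i\<close>.
\<close>

lemma qvar_powi_eq_1_iff: "qvar powi n = 1 \<longleftrightarrow> n = 0"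
  by (cases "n \<ge> 0") (auto simp: power_int_def qvar_power_eq_1_iff power_inverse)

lemma q_i_powi_eq_iff:
  assumes "symmetrizer D i > 0"
  shows "q_i D i powi m = q_i D i powi n \<longleftrightarrow> m = n"
proof -
  have *: "q_i D i powi k = qvar powi (int (symmetrizer D i) * k)" for k
    by (simp add: q_i_def power_int_mult)
  have "q_i D i powi m = q_i D i powi n \<longleftrightarrow> qvar powi (int (symmetrizer D i) * (m - n)) = 1"
    unfolding * right_diff_distrib by (subst power_int_diff) auto
  with assms show ?thesis by (simp add: qvar_powi_eq_1_iff)
qed

lemma q_i_nonzero [simp]: "q_i D i \<noteq> 0"
  by (simp add: q_i_def)

locale quantum_module =
  fixes D :: "'i::finite cartan_datum" and M :: "('i, 'v::ab_group_add) uq_rep"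
  assumes finite_type: "finite_type D" and uq_module: "uq_module D M"
begin

sublocale vector_space "smult M"
  using uq_module by (simp add: uq_module_def)

lemma linear_F: "Vector_Spaces.linear (smult M) (smult M) (opF M i)"
  and linear_K: "Vector_Spaces.linear (smult M) (smult M) (opK M i)"
  and linear_E: "Vector_Spaces.linear (smult M) (smult M) (opE M i)"
  using uq_module by (simp_all add: uq_module_def)

lemmas F_scale = module_hom.scale[OF linear_F[unfolded linear_iff_module_hom]]
lemmas K_scale = module_hom.scale[OF linear_K[unfolded linear_iff_module_hom]]
lemmas K_sum = module_hom.sum[OF linear_K[unfolded linear_iff_module_hom]]
lemmas E_scale = module_hom.scale[OF linear_E[unfolded linear_iff_module_hom]]

lemma K_F: "opK M j (opF M i v) = smult M (q_i D j powi (- cartan D j i)) (opF M i (opK M j v))"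
  using uq_module by (simp add: uq_module_def)

lemma q_i_powi_eq: "q_i D i powi m = q_i D i powi n \<longleftrightarrow> m = n"
  using finite_type by (intro q_i_powi_eq_iff) (simp add: finite_type_def)

lemma weight_space_scale: "v \<in> weight_space D M \<mu> \<Longrightarrow> smult M c v \<in> weight_space D M \<mu>"
  by (simp add: weight_space_def K_scale scale_scale mult.commute)

lemma weight_space_sum:
  "(\<And>x. x \<in> A \<Longrightarrow> g x \<in> weight_space D M \<mu>) \<Longrightarrow> sum g A \<in> weight_space D M \<mu>"
  by (simp add: weight_space_def K_sum scale_sum_right)

lemma zero_weight: "0 \<in> weight_space D M \<mu>"
  using weight_space_sum[of "{}" "\<lambda>_. 0"] by simp

lemma weight_space_F:
  assumes "v \<in> weight_space D M \<mu>"
  shows "opF M i v \<in> weight_space D M (\<lambda>j. \<mu> j - cartan D j i)"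
  using assms
  by (simp add: weight_space_def K_F F_scale scale_scale flip: power_int_add)

lemma weight_space_div_power_F:
  assumes "v \<in> weight_space D M \<mu>"
  shows "div_power D M (opF M) i n v \<in> weight_space D M (\<lambda>j. \<mu> j - int n * cartan D j i)"
proof -
  have "(opF M i ^^ n) v \<in> weight_space D M (\<lambda>j. \<mu> j - int n * cartan D j i)"
  proof (induction n)
    case (Suc n)
    then show ?case using weight_space_F[OF Suc, of i] by (simp add: algebra_simps)
  qed (use assms in simp)
  then show ?thesis unfolding div_power_def by (rule weight_space_scale)
qed

lemma div_power_F_scale:
  "div_power D M (opF M) i n (smult M c v) = smult M c (div_power D M (opF M) i n v)"
proof -
  have "(opF M i ^^ n) (smult M c v) = smult M c ((opF M i ^^ n) v)"
    by (induction n) (simp_all add: F_scale)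
  then show ?thesis by (simp add: div_power_def mult.commute)
qed

text \<open>
  The scalar is the ratio of the \<open>K\<^sub>j\<close>-eigenvalue on the summand \<open>F\<^sub>i\<^sup>(\<^sup>n\<^sup>) u\<^sub>p\<close> to the one on \<open>v\<close>.
  Applying \<open>K\<^sub>j\<close> to the decomposition and dividing by the eigenvalue of \<open>v\<close> therefore gives \<open>v\<close> again,
  with the same nonzero components up to these scalars.
\<close>

lemma string_decomposition_rescale:
  assumes v: "v \<in> weight_space D M \<mu>" and u: "string_decomposition D M i v u"
  shows "string_decomposition D M i v
    (\<lambda>p. smult M (q_i D j powi (fst p j - int (snd p) * cartan D j i - \<mu> j)) (u p))"
    (is "string_decomposition D M i v ?u")
proof -
  let ?c = "\<lambda>p. q_i D j powi (fst p j - int (snd p) * cartan D j i - \<mu> j)"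
  let ?d = "\<lambda>p. div_power D M (opF M) i (snd p) (u p)"
  have supp: "{p. ?u p \<noteq> 0} = {p. u p \<noteq> 0}" by simp
  have uw: "u p \<in> weight_space D M (fst p)" for p
    using u by (cases p) (simp add: string_decomposition_def)
  have "smult M (q_i D j powi (\<mu> j)) v = opK M j v"
    using v by (simp add: weight_space_def)
  also have "\<dots> = (\<Sum>p | u p \<noteq> 0. opK M j (?d p))"
    using u by (simp add: string_decomposition_def K_sum)
  also have "\<dots> = (\<Sum>p | u p \<noteq> 0. smult M (q_i D j powi (\<mu> j)) (smult M (?c p) (?d p)))"
    using weight_space_div_power_F[OF uw]
    by (intro sum.cong refl) (simp add: weight_space_def flip: power_int_add)
  also have "\<dots> = smult M (q_i D j powi (\<mu> j)) (\<Sum>p | u p \<noteq> 0. smult M (?c p) (?d p))"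
    by (simp add: scale_sum_right)
  finally have "v = (\<Sum>p | u p \<noteq> 0. smult M (?c p) (?d p))"
    by (simp del: scale_scale)
  then have "v = (\<Sum>p | ?u p \<noteq> 0. div_power D M (opF M) i (snd p) (?u p))"
    unfolding supp by (simp only: div_power_F_scale)
  then show ?thesis
    using u unfolding string_decomposition_def supp
    by (auto intro: weight_space_scale simp: E_scale)
qed

text \<open>
  The rescaled decomposition must be the original one, so the rescaling factor of every nonzero
  summand is 1.
\<close>

lemma string_decomposition_support:
  assumes v: "v \<in> weight_space D M \<mu>" and u: "string_decomposition D M i v u"
    and uniq: "\<exists>!u. string_decomposition D M i v u" and p: "u p \<noteq> 0"
  shows "fst p j - int (snd p) * cartan D j i = \<mu> j"
proof -
  let ?c = "q_i D j powi (fst p j - int (snd p) * cartan D j i - \<mu> j)"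
  have "smult M ?c (u p) = u p"
    using uniq u string_decomposition_rescale[OF v u, of j] by (metis (no_types, lifting))
  then have "?c = 1" using p scale_cancel_right[of ?c "u p" 1] by simp
  then show ?thesis using q_i_powi_eq[of j _ 0] by simp
qed

lemma weight_space_kashiwara_f:
  assumes v: "v \<in> weight_space D M \<mu>"
  shows "kashiwara_f D M i v \<in> weight_space D M (\<lambda>j. \<mu> j - cartan D j i)"
proof (cases "\<exists>!u. string_decomposition D M i v u")
  case True
  define u where "u = (THE u. string_decomposition D M i v u)"
  have u: "string_decomposition D M i v u"
    unfolding u_def using True by (rule theI')
  have "div_power D M (opF M) i (snd p + 1) (u p) \<in> weight_space D M (\<lambda>j. \<mu> j - cartan D j i)"
    if "u p \<noteq> 0" for p
  proof -
    have "u p \<in> weight_space D M (fst p)"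
      using u by (cases p) (simp add: string_decomposition_def)
    from weight_space_div_power_F[OF this, of i "snd p + 1"] show ?thesis
      using string_decomposition_support[OF v u True that]
      by (simp add: algebra_simps)
  qed
  then show ?thesis
    using True by (auto simp: kashiwara_f_def Let_def simp flip: u_def intro: weight_space_sum)
qed (auto simp: kashiwara_f_def zero_weight)

text \<open>
  The usual argument for eigenvectors: to eliminate the summand of weight \<open>\<nu>\<close>, apply
  \<open>K\<^sub>j - q_i D j powi \<nu> j\<close>. For each other weight \<open>\<mu>\<close> some \<open>j\<close> distinguishes it from \<open>\<nu>\<close>, so that its summand is
  multiplied by a nonzero scalar.
\<close>

lemma weight_vectors_sum_zero:
  assumes "finite A" "\<And>\<mu>. \<mu> \<in> A \<Longrightarrow> g \<mu> \<in> weight_space D M \<mu>" "(\<Sum>\<mu>\<in>A. g \<mu>) = 0"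
  shows "\<forall>\<mu>\<in>A. g \<mu> = 0"
  using assms
proof (induction A arbitrary: g)
  case (insert \<nu> A)
  have "g \<mu> = 0" if "\<mu> \<in> A" for \<mu>
  proof -
    from that insert.hyps have "\<mu> \<noteq> \<nu>" by auto
    then obtain j where j: "\<mu> j \<noteq> \<nu> j" by auto
    let ?c = "\<lambda>\<mu>. q_i D j powi \<mu> j - q_i D j powi \<nu> j"
    have K: "opK M j (g \<mu>) = smult M (q_i D j powi \<mu> j) (g \<mu>)" if "\<mu> \<in> insert \<nu> A" for \<mu>
      using insert.prems(1)[OF that] by (simp add: weight_space_def)
    have "0 = opK M j (\<Sum>\<mu>\<in>insert \<nu> A. g \<mu>) - smult M (q_i D j powi \<nu> j) (\<Sum>\<mu>\<in>insert \<nu> A. g \<mu>)"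
      using insert.prems(2) K_sum[of j "\<lambda>_. 0" "{}"] by simp
    also have "\<dots> = (\<Sum>\<mu>\<in>insert \<nu> A. smult M (?c \<mu>) (g \<mu>))"
      using K by (simp add: K_sum scale_sum_right scale_left_diff_distrib sum_subtractf
          del: sum.insert insert_iff)
    also have "\<dots> = (\<Sum>\<mu>\<in>A. smult M (?c \<mu>) (g \<mu>))"
      using insert.hyps by simp
    finally have "(\<Sum>\<mu>\<in>A. smult M (?c \<mu>) (g \<mu>)) = 0" ..
    then have "\<forall>\<mu>\<in>A. smult M (?c \<mu>) (g \<mu>) = 0"
      by (intro insert.IH weight_space_scale insert.prems(1) insertI2)
    then have "smult M (?c \<mu>) (g \<mu>) = 0" using that by blast
    then show ?thesis using j q_i_powi_eq by simp
  qed
  moreover from this have "g \<nu> = 0"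
    using insert.hyps insert.prems(2) by simp
  ultimately show ?case by blast
qed simp

text \<open>
  Choosing a nonzero vector of each weight gives a linearly independent set, which cannot be larger
  than a finite spanning set.
\<close>

lemma finite_weights:
  assumes "finite S" "span S = UNIV"
  shows "finite {\<mu>. weight_space D M \<mu> \<noteq> {0}}" (is "finite ?W")
proof -
  have "\<exists>v. v \<noteq> 0 \<and> v \<in> weight_space D M \<mu>" if "\<mu> \<in> ?W" for \<mu>
    using that zero_weight[of \<mu>] by auto
  then have "\<forall>\<mu>\<in>?W. \<exists>v. v \<noteq> 0 \<and> v \<in> weight_space D M \<mu>" by blast
  then obtain g where g: "\<And>\<mu>. \<mu> \<in> ?W \<Longrightarrow> g \<mu> \<noteq> 0 \<and> g \<mu> \<in> weight_space D M \<mu>"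
    by (elim bchoice[THEN exE]) blast
  have inj: "inj_on g ?W"
  proof (rule inj_onI, rule ccontr)
    fix \<mu> \<nu> assume *: "\<mu> \<in> ?W" "\<nu> \<in> ?W" "g \<mu> = g \<nu>" "\<mu> \<noteq> \<nu>"
    then obtain j where "\<mu> j \<noteq> \<nu> j" by auto
    moreover have "smult M (q_i D j powi \<mu> j) (g \<mu>) = opK M j (g \<mu>)"
      using g[OF *(1)] by (simp add: weight_space_def)
    moreover have "smult M (q_i D j powi \<nu> j) (g \<mu>) = opK M j (g \<mu>)"
      using g[OF *(2)] unfolding *(3) by (simp add: weight_space_def)
    ultimately show False using g[OF *(1)] q_i_powi_eq by (metis scale_cancel_right)
  qed
  have "independent (g ` ?W)"
    unfolding independent_explicit_module
  proof (intro allI impI)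
    fix T c v
    assume T: "finite T" "T \<subseteq> g ` ?W" "(\<Sum>v\<in>T. smult M (c v) v) = 0" "v \<in> T"
    from T(2) obtain A where A: "A \<subseteq> ?W" "T = g ` A" by (rule subset_imageE)
    have inj_A: "inj_on g A" using inj A(1) by (rule inj_on_subset)
    have "finite A" using T(1) inj_A unfolding A(2) by (simp add: finite_image_iff)
    moreover have "(\<Sum>\<mu>\<in>A. smult M (c (g \<mu>)) (g \<mu>)) = 0"
      using T(3) inj_A unfolding A(2) by (simp add: sum.reindex)
    ultimately have "\<forall>\<mu>\<in>A. smult M (c (g \<mu>)) (g \<mu>) = 0"
      using g A(1) by (intro weight_vectors_sum_zero weight_space_scale) blast+
    moreover obtain \<mu> where "\<mu> \<in> A" "v = g \<mu>" using T(4) A(2) by blast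
    moreover from this have "g \<mu> \<noteq> 0" using g A(1) by blast
    ultimately show "c v = 0" by (metis scale_eq_0_iff)
  qed
  then have "finite (g ` ?W)"
    using independent_span_bound[OF assms(1)] assms(2) by simp
  then show ?thesis using inj by (simp add: finite_image_iff)
qed

end

section \<open>The order on weights\<close>

definition root_step :: "'i cartan_datum \<Rightarrow> ('i weight \<times> 'i weight) set" where
  "root_step D = {(\<nu>, \<mu>). \<exists>i. \<nu> = (\<lambda>j. \<mu> j - cartan D j i)}"

text \<open>
  Here \<open>n i\<close> counts the steps along \<open>\<alpha>\<^sub>i\<close>, so that \<open>n \<noteq> 0\<close> because there is at least one step.
\<close>

lemma root_step_trancl:
  fixes D :: "'i::finite cartan_datum"
  assumes "(\<nu>, \<mu>) \<in> (root_step D)\<^sup>+"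
  shows "\<exists>n :: 'i \<Rightarrow> nat. n \<noteq> (\<lambda>_. 0) \<and>
    (\<forall>j. \<mu> j = \<nu> j + (\<Sum>i\<in>UNIV. cartan D j i * int (n i)))"
  using assms
proof (induction rule: trancl_induct)
  case (base \<mu>)
  then obtain i where i: "\<nu> = (\<lambda>j. \<mu> j - cartan D j i)" by (auto simp: root_step_def)
  have "\<mu> j = \<nu> j + (\<Sum>k\<in>UNIV. cartan D j k * int (if k = i then 1 else 0))" for j
    by (simp add: i if_distrib cong: if_cong)
  moreover have "(\<lambda>k. if k = i then 1 else 0 :: nat) \<noteq> (\<lambda>_. 0)"
    by (auto simp: fun_eq_iff)
  ultimately show ?case by blast
next
  case (step \<mu> \<kappa>)
  then obtain n where n: "\<And>j. \<mu> j = \<nu> j + (\<Sum>i\<in>UNIV. cartan D j i * int (n i))" by blast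
  from step obtain i where i: "\<mu> = (\<lambda>j. \<kappa> j - cartan D j i)" by (auto simp: root_step_def)
  let ?n = "\<lambda>k. n k + (if k = i then 1 else 0)"
  have "\<kappa> j = \<nu> j + (\<Sum>k\<in>UNIV. cartan D j k * int (?n k))" for j
  proof -
    have "(\<Sum>k\<in>UNIV. cartan D j k * int (?n k))
        = (\<Sum>k\<in>UNIV. cartan D j k * int (n k) + (if k = i then cartan D j k else 0))"
      by (intro sum.cong refl) (auto simp: distrib_left)
    also have "\<dots> = (\<Sum>k\<in>UNIV. cartan D j k * int (n k)) + cartan D j i"
      by (simp only: sum.distrib sum.delta' sum.delta finite UNIV_I if_True)
    finally show ?thesis using n[of j] fun_cong[OF i, of j] by linarith
  qed
  moreover have "?n \<noteq> (\<lambda>_. 0)" by (auto simp: fun_eq_iff)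
  ultimately show ?case by blast
qed

text \<open>
  A cycle would give multiplicities \<open>n \<noteq> 0\<close> with \<open>\<Sum>\<^sub>i n\<^sub>i \<alpha>\<^sub>i = 0\<close>, that is, a nonzero vector of norm
  zero for the positive definite symmetrized Cartan form.
\<close>

lemma acyclic_root_step:
  assumes "finite_type D"
  shows "acyclic (root_step D)"
proof (rule acyclicI, intro allI notI)
  fix \<mu> assume "(\<mu>, \<mu>) \<in> (root_step D)\<^sup>+"
  from root_step_trancl[OF this] obtain n :: "'a \<Rightarrow> nat" where n: "n \<noteq> (\<lambda>_. 0)"
    and "\<forall>j. \<mu> j = \<mu> j + (\<Sum>i\<in>UNIV. cartan D j i * int (n i))"
    by (elim exE conjE)
  then have n0: "(\<Sum>i\<in>UNIV. cartan D j i * int (n i)) = 0" for j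
    by (metis add_cancel_right_right)
  let ?x = "\<lambda>i. real (n i)"
  have "?x \<noteq> (\<lambda>_. 0)" using n by (auto simp: fun_eq_iff)
  then have "(\<Sum>i\<in>UNIV. \<Sum>j\<in>UNIV. real (symmetrizer D i) * of_int (cartan D i j) * ?x i * ?x j) > 0"
    using assms unfolding finite_type_def by blast
  moreover have "(\<Sum>j\<in>UNIV. real (symmetrizer D i) * of_int (cartan D i j) * ?x i * ?x j) =
      real (symmetrizer D i) * ?x i * of_int (\<Sum>j\<in>UNIV. cartan D i j * int (n j))" for i
    by (simp add: sum_distrib_left mult_ac)
  ultimately show False by (simp only: n0) simp
qed


section \<open>The crystal of a crystal basis\<close>

lemma regular_at_0_diff:
  assumes "x \<in> regular_at_0" "y \<in> regular_at_0"
  shows "x - y \<in> regular_at_0"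
proof -
  from assms obtain a b c d where x: "x = Fract a b" "poly b 0 \<noteq> 0" and y: "y = Fract c d" "poly d 0 \<noteq> 0"
    unfolding regular_at_0_def by blast
  have "b \<noteq> 0" "d \<noteq> 0" using x(2) y(2) by auto
  then have "x - y = Fract (a * d - c * b) (b * d)"
    unfolding x(1) y(1) by (rule diff_fract)
  moreover have "poly (b * d) 0 \<noteq> 0" using x(2) y(2) by simp
  ultimately show ?thesis unfolding regular_at_0_def by blast
qed

locale module_with_crystal_basis = quantum_module D M
  for D :: "'i::finite cartan_datum" and M :: "('i, 'v::ab_group_add) uq_rep" +
  fixes L :: "'v set" and B :: "'v set set"
  assumes crystal_basis: "crystal_basis D M L B"
begin

lemma lattice_diff:
  assumes "v \<in> L" "w \<in> L"
  shows "v - w \<in> L"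
proof -
  obtain S where L: "L = {\<Sum>s\<in>S. smult M (a s) s | a. \<forall>s\<in>S. a s \<in> regular_at_0}"
    using crystal_basis unfolding crystal_basis_def crystal_lattice_def by (elim conjE exE)
  from assms obtain a b where
    v: "v = (\<Sum>s\<in>S. smult M (a s) s)" "\<forall>s\<in>S. a s \<in> regular_at_0" and
    w: "w = (\<Sum>s\<in>S. smult M (b s) s)" "\<forall>s\<in>S. b s \<in> regular_at_0"
    unfolding L by blast
  have "v - w = (\<Sum>s\<in>S. smult M (a s - b s) s)"
    unfolding v(1) w(1) by (simp only: scale_left_diff_distrib sum_subtractf)
  moreover have "\<forall>s\<in>S. a s - b s \<in> regular_at_0"
    using v(2) w(2) regular_at_0_diff by blast
  ultimately show ?thesis unfolding L by (intro CollectI exI[of _ "\<lambda>s. a s - b s"] conjI)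
qed

text \<open>
  Classes are cosets of the additive group \<open>q L\<close>.
\<close>

lemma q_class_eq:
  assumes "0 \<in> L" and "v \<in> q_class M L w"
  shows "q_class M L v = q_class M L w"
proof -
  from assms(2) obtain t where t: "t \<in> L" "v = w + smult M qvar t"
    by (auto simp: q_class_def)
  have add: "s + t \<in> L" if "s \<in> L" for s
    using lattice_diff[OF that lattice_diff[OF assms(1) t(1)]] by simp
  have "x \<in> q_class M L v \<longleftrightarrow> x \<in> q_class M L w" for x
  proof
    assume "x \<in> q_class M L v"
    then obtain s where s: "s \<in> L" "x = v + smult M qvar s" by (auto simp: q_class_def)
    then have "x = w + smult M qvar (s + t)" by (simp add: t scale_right_distrib)
    with add s show "x \<in> q_class M L w" unfolding q_class_def by blast
  next
    assume "x \<in> q_class M L w"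
    then obtain s where s: "s \<in> L" "x = w + smult M qvar s" by (auto simp: q_class_def)
    then have "x = v + smult M qvar (s - t)" by (simp add: t scale_right_diff_distrib)
    with lattice_diff s t show "x \<in> q_class M L v" unfolding q_class_def by blast
  qed
  then show ?thesis by blast
qed

lemma mem_q_class: "0 \<in> L \<Longrightarrow> v \<in> q_class M L v"
  unfolding q_class_def by (intro CollectI exI[of _ 0]) simp

lemma basis_weight: "b \<in> B \<Longrightarrow> \<exists>!\<mu>. b \<in> q_class M L ` (L \<inter> weight_space D M \<mu>)"
  using crystal_basis by (simp add: crystal_basis_def)

lemma basis_zero_in_lattice:
  assumes "b \<in> B"
  shows "0 \<in> L"
proof -
  obtain v where "v \<in> L" using basis_weight[OF assms] by blast
  then show ?thesis using lattice_diff[of v v] by simp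
qed

definition basis_wt where
  "basis_wt b = (THE \<mu>. b \<in> q_class M L ` (L \<inter> weight_space D M \<mu>))"

lemma basis_wt: "b \<in> B \<Longrightarrow> b \<in> q_class M L ` (L \<inter> weight_space D M (basis_wt b))"
  unfolding basis_wt_def by (rule theI'[OF basis_weight])

lemma basis_wt_eqI:
  "b \<in> B \<Longrightarrow> b \<in> q_class M L ` (L \<inter> weight_space D M \<mu>) \<Longrightarrow> basis_wt b = \<mu>"
  unfolding basis_wt_def by (rule the1_equality[OF basis_weight])

text \<open>
  The zero vector belongs to every weight space, so the class of zero would violate the uniqueness of
  the weight of a basis element.
\<close>

lemma zero_class_notin: "q_class M L 0 \<notin> B"
proof
  assume *: "q_class M L 0 \<in> B"
  have wt: "basis_wt (q_class M L 0) = \<mu>" for \<mu>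
    by (rule basis_wt_eqI[OF *]) (use zero_weight basis_zero_in_lattice[OF *] in blast)
  have "(\<lambda>_ :: 'i. 0) = (\<lambda>_. 1 :: int)"
    by (rule trans[OF sym[OF wt] wt])
  then show False by (simp add: fun_eq_iff)
qed

lemma basis_wt_weight_of_module:
  assumes "b \<in> B"
  shows "weight_space D M (basis_wt b) \<noteq> {0}"
proof
  assume *: "weight_space D M (basis_wt b) = {0}"
  obtain v where "b = q_class M L v" "v \<in> weight_space D M (basis_wt b)"
    using basis_wt[OF assms] by blast
  then have "b = q_class M L 0" unfolding * by simp
  with assms zero_class_notin show False by simp
qed

text \<open>
  The induced operator is a union of cosets over all representatives. When this union is a single
  coset, any one representative determines it.
\<close>

lemma induced_op_eq_class:
  assumes b': "b' \<in> B" and eq: "induced_op M L T b = b'" and v: "v \<in> b"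
  shows "b' = q_class M L (T v)"
proof -
  have z: "0 \<in> L" using basis_zero_in_lattice[OF b'] .
  obtain w where w: "b' = q_class M L w" using basis_wt[OF b'] by blast
  have "T v \<in> q_class M L (T v)"
    using z by (rule mem_q_class)
  then have "T v \<in> q_class M L w" using v unfolding w[symmetric] eq[symmetric] induced_op_def
    by (rule UN_I[rotated])
  then show ?thesis using q_class_eq[OF z] w by simp
qed

text \<open>
  A weight vector can be taken as representative of \<open>b\<close>, and \<open>f\<^sub>i\<close> maps it to a weight vector.
\<close>

lemma basis_wt_kashiwara_f:
  assumes b: "b \<in> B" and b': "b' \<in> B" and eq: "induced_op M L (kashiwara_f D M i) b = b'"
  shows "basis_wt b' = (\<lambda>j. basis_wt b j - cartan D j i)"
proof (rule basis_wt_eqI[OF b'])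
  obtain v where v: "b = q_class M L v" "v \<in> L" "v \<in> weight_space D M (basis_wt b)"
    using basis_wt[OF b] by blast
  have "v \<in> b"
    unfolding v(1) by (rule mem_q_class[OF basis_zero_in_lattice[OF b]])
  then have "b' = q_class M L (kashiwara_f D M i v)"
    using induced_op_eq_class[OF b' eq] by blast
  moreover have "kashiwara_f D M i v \<in> L"
    using crystal_basis v(2) by (simp add: crystal_basis_def crystal_lattice_def)
  ultimately show
    "b' \<in> q_class M L ` (L \<inter> weight_space D M (\<lambda>j. basis_wt b j - cartan D j i))"
    using weight_space_kashiwara_f[OF v(3)] by blast
qed

abbreviation "crys \<equiv> crystal_of_basis D M L B"

lemma elems_crys [simp]: "elems crys = B"
  by (simp add: crystal_of_basis_def)

lemma lower_crys_iff:
  assumes "b \<in> B"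
  shows "lower crys i b = Some b' \<longleftrightarrow> b' \<in> B \<and> induced_op M L (kashiwara_f D M i) b = b'"
proof -
  have "induced_op M L (kashiwara_f D M i) b \<in> insert (q_class M L 0) B"
    using assms crystal_basis unfolding crystal_basis_def by blast
  then show ?thesis
    using zero_class_notin by (auto simp only: crystal_of_basis_def Let_def crystal.simps
        insert_iff option.simps split: if_splits)
qed

lemma raise_crys_iff:
  assumes "b \<in> B"
  shows "raise crys i b = Some b' \<longleftrightarrow> b' \<in> B \<and> induced_op M L (kashiwara_e D M i) b = b'"
proof -
  have "induced_op M L (kashiwara_e D M i) b \<in> insert (q_class M L 0) B"
    using assms crystal_basis unfolding crystal_basis_def by blast
  then show ?thesis
    using zero_class_notin by (auto simp only: crystal_of_basis_def Let_def crystal.simps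
        insert_iff option.simps split: if_splits)
qed

lemma lower_iff_raise:
  assumes "b \<in> B" "b' \<in> B"
  shows "lower crys i b = Some b' \<longleftrightarrow> raise crys i b' = Some b"
proof -
  have "\<forall>i. \<forall>b\<in>B. \<forall>b'\<in>B. induced_op M L (kashiwara_f D M i) b = b' \<longleftrightarrow>
      induced_op M L (kashiwara_e D M i) b' = b"
    using crystal_basis unfolding crystal_basis_def by (elim conjE)
  with assms show ?thesis
    unfolding lower_crys_iff[OF assms(1)] raise_crys_iff[OF assms(2)] by blast
qed

text \<open>
  The weight maps lowering steps into a finite acyclic relation, which is well-founded in both
  directions.
\<close>

theorem wellfounded_crystal:
  assumes S: "finite S" "span S = UNIV"
  shows "wellfounded_crystal crys"
proof
  let ?W = "{\<mu>. weight_space D M \<mu> \<noteq> {0}}"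
  let ?R = "root_step D \<inter> ?W \<times> ?W"
  have fin: "finite ?R" using finite_weights[OF S] by simp
  have acyc: "acyclic ?R"
    using acyclic_root_step[OF finite_type] by (rule acyclic_subset) simp
  have low: "(basis_wt b', basis_wt b) \<in> ?R" if "b \<in> B" "lower crys i b = Some b'" for i b b'
  proof -
    have b': "b' \<in> B" "induced_op M L (kashiwara_f D M i) b = b'"
      using that lower_crys_iff by blast+
    have "(basis_wt b', basis_wt b) \<in> root_step D"
      unfolding basis_wt_kashiwara_f[OF that(1) b'] root_step_def by blast
    then show ?thesis using basis_wt_weight_of_module that(1) b'(1) by blast
  qed
  have rais: "(basis_wt b', basis_wt b) \<in> ?R\<inverse>" if "b \<in> B" "raise crys i b = Some b'" for i b b'
  proof -
    have "b' \<in> B" using that raise_crys_iff by blast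
    then show ?thesis using that low lower_iff_raise by blast
  qed
  show "wf {(y, x). x \<in> elems crys \<and> (\<exists>i. lower crys i x = Some y)}"
    by (rule wf_subset[OF wf_inv_image[OF finite_acyclic_wf[OF fin acyc], of basis_wt]])
      (use low in \<open>auto simp: inv_image_def\<close>)
  show "wf {(y, x). x \<in> elems crys \<and> (\<exists>i. raise crys i x = Some y)}"
    by (rule wf_subset[OF wf_inv_image[OF finite_acyclic_wf_converse[OF fin acyc], of basis_wt]])
      (use rais in \<open>auto simp: inv_image_def\<close>)
  show "y \<in> elems crys" if "x \<in> elems crys" "raise crys i x = Some y" for x i y
    using that by (simp add: raise_crys_iff)
  show "raise crys i y = Some x" if "x \<in> elems crys" "lower crys i x = Some y" for x i y
    using that lower_iff_raise[of x y] by (auto simp: lower_crys_iff)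
qed

end

theorem proposition4p0p1:
  fixes D :: "'i::finite cartan_datum"
    and M :: "('i, 'v::ab_group_add) uq_rep"
    and lam :: "'i weight"
    and C :: "('i, 'v set) crystal"
    and X :: "'v set set"
  assumes "finite_type D"
    and "dominant lam"
    and "highest_weight_crystal D M lam C"
    and "extremal C X"
  shows "X = raising_closure C (lowest_weight_elements C X)"
proof -
  from assms(3) obtain L B where LB: "crystal_basis D M L B" "C = crystal_of_basis D M L B"
    and M: "uq_module D M" "\<exists>S. finite S \<and> module.span (smult M) S = UNIV"
    by (auto simp: highest_weight_crystal_def simple_highest_weight_module_def)
  interpret module_with_crystal_basis D M L B
    by unfold_locales (use assms(1) M LB in auto)
  obtain S where "finite S" "span S = UNIV" using M(2) by blast
  then have "wellfounded_crystal C" using wellfounded_crystal LB(2) by blast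
  then show ?thesis using wellfounded_crystal.extremal_eq_raising_closure assms(4) by blast
qed

end
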